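(* Let $T\ge 0$ be an integer (the burn-in length). Let $(X^{(i)})_{i\ge 0}$ and $(\tilde X^{(i)})_{i\ge 0}$ be the forward-coupled pair of independence Metropolis--Hastings chains with target $P$ and proposal $Q$ (defined in the context), and put $$Y^{(i)}=\frac{1}{w(X^{(i+T)})},\qquad \tilde Y^{(i)}=\frac{1}{w(\tilde X^{(i+T)})}\qquad (i\ge 0).$$ Let $N$ be a random nonnegative integer, independent of the chains, with $\Pr(N\ge i)>0$ for all $i\ge 0$, and let $$S = Y^{(0)}+\sum_{i=1}^{N}\frac{Y^{(i)}-\tilde Y^{(i-1)}}{\Pr(N\ge i)}.$$ Then $$\Pr[S\ge 0]\ \ge\ 1-\frac{2}{T+1}.$$
   Context: $P$ is a probability density on a state space $\mathcal X$ (with respect to a fixed reference measure), $P(x)=P^*(x)/Z$ with $P^*$ unnormalized and $0<Z=\int P^*(x)\,dx<\infty$; $Q$ is a normalized probability density on $\mathcal X$. $P^*$ and $Q$ are strictly positive on $\mathcal X$. The importance weight is $w(x)=P^*(x)/Q(x)$. Let $X_{\mathrm{prop}}^{(0)},X_{\mathrm{prop}}^{(1)},X_{\mathrm{prop}}^{(2)},\dots$ be i.i.d. from $Q$ and let $r^{(0)},r^{(1)},\dots$ be i.i.d. Uniform$[0,1]$, independent of the proposals. The Metropolis--Hastings update map is $$\phi(x,x',r)=\begin{cases}x' & \text{if } r<\min\{1,\,w(x')/w(x)\},\\ x & \text{otherwise,}\end{cases}$$ and $\phi^{(i+1)}(\cdot)=\phi(\cdot,X_{\mathrm{prop}}^{(i+1)},r^{(i)})$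 for $i\ge 0$. Forward coupling: set $X^{(0)}=\tilde X^{(0)}=X_{\mathrm{prop}}^{(0)}$ and, for $i\ge1$, $$X^{(i)}=\phi^{(i)}(\phi^{(i-1)}(\cdots\phi^{(1)}(X^{(0)}))),\qquad \tilde X^{(i)}=\phi^{(i+1)}(\phi^{(i)}(\cdots\phi^{(2)}(X^{(0)}))).$$ *)

theory Defs
  imports "HOL-Probability.Probability"
begin

text \<open>
  Two random variables are independent if the sigma-algebras they generate are. The library constant
  \<open>prob_space.indep_var\<close> forces both variables to have the same value type, so its definition is
  repeated here for variables with values in spaces of different types.
\<close>

definition indep_rv ::
    "'w measure \<Rightarrow> 'b measure \<Rightarrow> ('w \<Rightarrow> 'b) \<Rightarrow> 'c measure \<Rightarrow> ('w \<Rightarrow> 'c) \<Rightarrow> bool" where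
  "indep_rv M S X R Y \<longleftrightarrow>
     X \<in> measurable M S \<and> Y \<in> measurable M R \<and>
     prob_space.indep_set M
       {X -` A \<inter> space M | A. A \<in> sets S} {Y -` B \<inter> space M | B. B \<in> sets R}"

definition importance_weight :: "('a \<Rightarrow> real) \<Rightarrow> ('a \<Rightarrow> real) \<Rightarrow> 'a \<Rightarrow> real" where
  "importance_weight Pstar Q x = Pstar x / Q x"

definition mh_update :: "('a \<Rightarrow> real) \<Rightarrow> 'a \<Rightarrow> 'a \<Rightarrow> real \<Rightarrow> 'a" where
  "mh_update w x x' r = (if r < min 1 (w x' / w x) then x' else x)"

text \<open>
  In the next three definitions \<open>p\<close> and \<open>r\<close> are realized sequences of proposals and uniform variates.
  \<open>mh_map w p r i\<close> is the update map with index \<open>i + 1\<close>: it uses proposal \<open>i + 1\<close> and variate \<open>i\<close>.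
\<close>

definition mh_map :: "('a \<Rightarrow> real) \<Rightarrow> (nat \<Rightarrow> 'a) \<Rightarrow> (nat \<Rightarrow> real) \<Rightarrow> nat \<Rightarrow> 'a \<Rightarrow> 'a" where
  "mh_map w p r i x = mh_update w x (p (Suc i)) (r i)"

primrec mh_chain :: "('a \<Rightarrow> real) \<Rightarrow> (nat \<Rightarrow> 'a) \<Rightarrow> (nat \<Rightarrow> real) \<Rightarrow> nat \<Rightarrow> 'a" where
  "mh_chain w p r 0 = p 0"
| "mh_chain w p r (Suc i) = mh_map w p r i (mh_chain w p r i)"

text \<open>
  The coupled chain starts at the same point but skips the first update map, so that its
  state \<open>i\<close> has been obtained from the update maps with indices \<open>2, \<dots>, i + 1\<close>.
\<close>

primrec mh_chain_coupled :: "('a \<Rightarrow> real) \<Rightarrow> (nat \<Rightarrow> 'a) \<Rightarrow> (nat \<Rightarrow> real) \<Rightarrow> nat \<Rightarrow> 'a" where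
  "mh_chain_coupled w p r 0 = p 0"
| "mh_chain_coupled w p r (Suc i) = mh_map w p r (Suc i) (mh_chain_coupled w p r i)"

end

theory Submission
  imports Defs
begin

text \<open>
  The update map is monotone with respect to the order that \<open>w\<close> induces on states, and an update that
  moves the chain of larger weight also moves the other one, to the same point. Hence \<open>S < 0\<close> forces
  \<open>w (Xprop 1) > w (Xprop 0)\<close> together with the rejection, by the chain that sits at \<open>Xprop 1\<close>, of all
  proposals \<open>2, \<dots>, T + 1\<close>. As a proposal of at least the current weight is always accepted,
  \<open>Xprop 1\<close> then has strictly the largest weight among \<open>T + 2\<close> exchangeable proposals, an event of
  probability at most \<open>1 / (T + 2)\<close>.
\<close>

text \<open>Exchangeability: the joint law is a power of one law \<open>D\<close>, so swapping two
  coordinates preserves it and every index is equally likely to be the strict maximiser. These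
  events are disjoint, so \<open>card I\<close> equal probabilities sum to at most 1; ties may make
  the sum smaller.\<close>

lemma (in prob_space) prob_strict_argmax_le:
  fixes V :: "'i \<Rightarrow> 'a \<Rightarrow> real"
  assumes indep: "indep_vars (\<lambda>_. borel) V I"
    and distr: "\<And>i. i \<in> I \<Longrightarrow> distr M borel (V i) = D"
    and I: "finite I" "k \<in> I"
  shows "prob {\<omega> \<in> space M. \<forall>j\<in>I - {k}. V j \<omega> < V k \<omega>} \<le> 1 / card I"
proof -
  have V [measurable]: "V i \<in> borel_measurable M" if "i \<in> I" for i
    using indep that by (auto simp: indep_vars_def)
  have D: "prob_space D" "sets D = sets borel"
    using distr[OF I(2)] prob_space_distr[OF V[OF I(2)]] by auto
  define L where "L = (\<Pi>\<^sub>M i\<in>I. D)"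
  define A where "A i = {v \<in> space L. \<forall>j\<in>I - {i}. v j < v i}" for i
  define E where "E i = {\<omega> \<in> space M. \<forall>j\<in>I - {i}. V j \<omega> < V i \<omega>}" for i
  have sets_L: "sets L = sets (\<Pi>\<^sub>M i\<in>I. (borel :: real measure))"
    unfolding L_def by (intro sets_PiM_cong) (simp_all add: D)
  have space_L: "space L = (\<Pi>\<^sub>E i\<in>I. UNIV)"
    using sets_eq_imp_space_eq[OF sets_L] by (simp add: space_PiM)
  have coord [measurable]: "(\<lambda>v. v i) \<in> borel_measurable L" if "i \<in> I" for i
    unfolding measurable_cong_sets[OF sets_L refl] using that by measurable
  have A [measurable]: "A i \<in> sets L" if "i \<in> I" for i
    unfolding A_def using I(1) that
    by (intro sets.sets_Collect_finite_All borel_measurable_less coord) auto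
  have E [measurable]: "E i \<in> events" if "i \<in> I" for i
    unfolding E_def using I(1) that
    by (intro sets.sets_Collect_finite_All borel_measurable_less V) auto
  have joint: "distr M (\<Pi>\<^sub>M i\<in>I. borel) (\<lambda>\<omega>. \<lambda>i\<in>I. V i \<omega>) = L"
  proof -
    have "distr M (\<Pi>\<^sub>M i\<in>I. borel) (\<lambda>\<omega>. \<lambda>i\<in>I. V i \<omega>) = (\<Pi>\<^sub>M i\<in>I. distr M borel (V i))"
      using indep I(2) V indep_vars_iff_distr_eq_PiM'[where I=I and M'="\<lambda>_. borel" and X=V] by blast
    also have "\<dots> = L"
      unfolding L_def by (intro PiM_cong refl distr)
    finally show ?thesis .
  qed
  have prob_E: "prob (E i) = measure L (A i)" if i: "i \<in> I" for i
  proof -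
    have "measure L (A i) = prob ((\<lambda>\<omega>. \<lambda>i\<in>I. V i \<omega>) -` A i \<inter> space M)"
      unfolding joint[symmetric] using A[OF i] sets_L by (intro measure_distr) auto
    also have "(\<lambda>\<omega>. \<lambda>i\<in>I. V i \<omega>) -` A i \<inter> space M = E i"
      using i by (auto simp: A_def E_def space_L)
    finally show ?thesis ..
  qed
  have A_eq: "measure L (A i) = measure L (A k)" if i: "i \<in> I" for i
  proof -
    \<comment> \<open>Precomposition with the transposition of \<open>i\<close> and \<open>k\<close>
      preserves \<open>L\<close>, whose factors are identical, and pulls \<open>A i\<close> back to
      \<open>A k\<close>.\<close>
    define f where "f = Transposition.transpose i k"
    have f: "f i = k" "f k = i" "f (f j) = j" for j
      by (simp_all add: f_def)
    have f_in: "f j \<in> I" if "j \<in> I" for j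
      using that i I(2) by (auto simp: f_def Transposition.transpose_def)
    have inj: "inj_on f I" by (simp add: f_def)
    have inv: "distr L L (\<lambda>v. \<lambda>j\<in>I. v (f j)) = L"
      unfolding L_def using distr_PiM_reindex[of I "\<lambda>_. D" f I] D(1) inj f_in by auto
    have meas: "(\<lambda>v. \<lambda>j\<in>I. v (f j)) \<in> L \<rightarrow>\<^sub>M L"
      unfolding L_def using f_in by (intro measurable_restrict measurable_component_singleton)
    have "measure L (A i) = measure (distr L L (\<lambda>v. \<lambda>j\<in>I. v (f j))) (A i)"
      by (simp add: inv)
    also have "\<dots> = measure L ((\<lambda>v. \<lambda>j\<in>I. v (f j)) -` A i \<inter> space L)"
      by (rule measure_distr[OF meas A[OF i]])
    also have "(\<lambda>v. \<lambda>j\<in>I. v (f j)) -` A i \<inter> space L = A k"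
    proof -
      have "(\<forall>j\<in>I - {i}. v (f j) < v k) \<longleftrightarrow> (\<forall>j\<in>I - {k}. v j < v k)" for v :: "'i \<Rightarrow> real"
        using f f_in by (metis DiffD1 DiffD2 DiffI singleton_iff)
      then show ?thesis
        using f f_in i by (auto simp: A_def space_L)
    qed
    finally show ?thesis .
  qed
  \<comment> \<open>Two strict maximisers would each exceed the other.\<close>
  have "disjoint_family_on E I"
    unfolding disjoint_family_on_def E_def by auto (metis DiffI less_asym singleton_iff)
  then have "(\<Sum>i\<in>I. prob (E i)) = prob (\<Union>i\<in>I. E i)"
    using I(1) by (intro finite_measure_finite_Union[symmetric]) auto
  also have "(\<Sum>i\<in>I. prob (E i)) = (\<Sum>i\<in>I. prob (E k))"
    using prob_E A_eq I(2) by (intro sum.cong refl) metis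
  finally have "card I * prob (E k) \<le> 1"
    by simp
  moreover have "card I > 0"
    using I card_gt_0_iff by blast
  ultimately show ?thesis
    by (simp add: E_def field_simps)
qed

text \<open>The acceptance threshold decreases in the current weight, so acceptance at
  \<open>y\<close> forces acceptance at \<open>x\<close>. If only \<open>x\<close> accepts, the
  rejection at \<open>y\<close> shows that the proposal weighs less than \<open>y\<close>.\<close>

lemma mh_map_mono:
  assumes "0 < w x" "0 < w (p (Suc i))" "w x \<le> w y"
  shows "w (mh_map w p r i x) \<le> w (mh_map w p r i y)"
proof -
  have "w (p (Suc i)) / w y \<le> w (p (Suc i)) / w x"
    using assms by (intro divide_left_mono) auto
  moreover have "w (p (Suc i)) \<le> w y" if "w (p (Suc i)) / w y < 1"
    using that assms by (simp add: field_simps)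
  ultimately show ?thesis
    using assms(3) by (auto simp: mh_map_def mh_update_def min_def split: if_splits)
qed

text \<open>If \<open>y\<close> accepts, so does \<open>x\<close>, and both land on the proposal.
  Rejection at \<open>y\<close> is excluded: since \<open>r i < 1\<close>, it would require a ratio
  below 1, hence a proposal strictly lighter than \<open>y\<close>.\<close>

lemma mh_map_coalesce:
  assumes "0 < w x" "0 < w (p (Suc i))" "w x \<le> w y" "r i < 1"
    and "\<not> (mh_map w p r i y = y \<and> w (p (Suc i)) < w y)"
  shows "mh_map w p r i y = mh_map w p r i x"
proof -
  have "w (p (Suc i)) / w y \<le> w (p (Suc i)) / w x"
    using assms by (intro divide_left_mono) auto
  moreover have "w (p (Suc i)) < w y" if "w (p (Suc i)) / w y < 1"
    using that assms by (simp add: field_simps)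
  ultimately show ?thesis
    using assms(4,5) by (auto simp: mh_map_def mh_update_def min_def split: if_splits)
qed

lemma mh_chain_pos:
  assumes "\<And>j. 0 < w (p j)"
  shows "0 < w (mh_chain w p r i)"
  using assms by (induction i) (auto simp: mh_map_def mh_update_def)

lemma mh_chain_coupled_pos:
  assumes "\<And>j. 0 < w (p j)"
  shows "0 < w (mh_chain_coupled w p r i)"
  using assms by (induction i) (auto simp: mh_map_def mh_update_def)

text \<open>State \<open>Suc i\<close> of the chain and state \<open>i\<close> of the coupled chain
  are next updated by the same map, so an ordering present after the first update persists by
  monotonicity.\<close>

lemma mh_chain_coupled_mono:
  assumes "\<And>j. 0 < w (p j)" "w (mh_chain w p r 1) \<le> w (p 0)"
  shows "w (mh_chain w p r (Suc i)) \<le> w (mh_chain_coupled w p r i)"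
proof (induction i)
  case (Suc i)
  then show ?case
    using mh_map_mono[of w "mh_chain w p r (Suc i)" p "Suc i"] mh_chain_pos[of w p r "Suc i"] assms(1)
    by simp
qed (use assms in simp)

lemma mh_chain_coupled_eq:
  assumes "mh_chain w p r (Suc i) = mh_chain_coupled w p r i" "i \<le> k"
  shows "mh_chain w p r (Suc k) = mh_chain_coupled w p r k"
  using assms(2,1) by (induction k rule: dec_induct) simp_all

text \<open>The weight bound on the coupled chain is carried along because both
  \<open>mh_map_mono\<close> and \<open>mh_map_coalesce\<close> need the two states ordered.\<close>

lemma mh_chain_coalesce_or_argmax:
  assumes pos: "\<And>j. 0 < w (p j)" and r: "\<And>j. r j < 1"
    and gt: "w (p 0) < w (mh_chain w p r 1)"
  shows "mh_chain w p r (Suc i) = mh_chain_coupled w p r i \<or>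
    mh_chain w p r (Suc i) = p 1 \<and> w (mh_chain_coupled w p r i) \<le> w (p 1) \<and>
      (\<forall>j\<in>{..Suc i} - {1}. w (p j) < w (p 1))"
proof (induction i)
  case 0
  have "mh_chain w p r 1 = p 1"
    using gt by (auto simp: mh_map_def mh_update_def split: if_splits)
  moreover have "{..Suc 0} - {1} = {0}" by auto
  ultimately show ?case using gt by simp
next
  case (Suc i)
  let ?x = "mh_chain_coupled w p r i" and ?f = "mh_map w p r (Suc i)"
  \<comment> \<open>Already met; still stuck at \<open>p 1\<close> after rejecting a strictly
    lighter proposal; or meeting at this update.\<close>
  consider "mh_chain w p r (Suc i) = ?x"
    | "mh_chain w p r (Suc i) = p 1" "w ?x \<le> w (p 1)" "\<forall>j\<in>{..Suc i} - {1}. w (p j) < w (p 1)"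
      "?f (p 1) = p 1" "w (p (Suc (Suc i))) < w (p 1)"
    | "mh_chain w p r (Suc i) = p 1" "w ?x \<le> w (p 1)"
      "\<not> (?f (p 1) = p 1 \<and> w (p (Suc (Suc i))) < w (p 1))"
    using Suc.IH by blast
  then show ?case
  proof cases
    case 1
    then show ?thesis by simp
  next
    case 2
    have "w (?f ?x) \<le> w (?f (p 1))"
      by (rule mh_map_mono[where w=w, OF mh_chain_coupled_pos[where w=w, OF pos] pos 2(2)])
    moreover have "\<forall>j\<in>{..Suc (Suc i)} - {1}. w (p j) < w (p 1)"
      using 2(3,5) by (auto simp: atMost_Suc)
    ultimately show ?thesis using 2(1,4) by simp
  next
    case 3
    have "?f (p 1) = ?f ?x"
      by (rule mh_map_coalesce[where w=w, OF mh_chain_coupled_pos[where w=w, OF pos] pos 3(2) r 3(3)])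
    then show ?thesis using 3(1) by simp
  qed
qed

text \<open>A pathwise statement for every truncation point \<open>n\<close>: each correction term
  is nonnegative by itself. The weights \<open>c\<close> stand for the tail probabilities of the
  truncation variable.\<close>

lemma mh_estimator_nonneg:
  fixes T n :: nat and c :: "nat \<Rightarrow> real"
  assumes pos: "\<And>j. 0 < w (p j)" and r: "\<And>j. r j < 1" and c: "\<And>i. 0 \<le> c i"
    and max: "\<not> (\<forall>j\<in>{..Suc T} - {1}. w (p j) < w (p 1))"
  shows "0 \<le> 1 / w (mh_chain w p r (0 + T)) +
    (\<Sum>i = 1..n. (1 / w (mh_chain w p r (i + T)) - 1 / w (mh_chain_coupled w p r (i - 1 + T))) / c i)"
proof -
  \<comment> \<open>For \<open>i \<ge> 1\<close> the index \<open>i + T\<close> is the successor of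
    \<open>i - 1 + T\<close>, the lag at which the chains are compared. Either the first update does
    not raise the weight, or the chains have met by lagged index \<open>T\<close> and stay
    together.\<close>
  have "w (mh_chain w p r (i + T)) \<le> w (mh_chain_coupled w p r (i - 1 + T))" if "i \<ge> 1" for i
  proof (cases "w (mh_chain w p r 1) \<le> w (p 0)")
    case True
    from mh_chain_coupled_mono[OF pos this, of "i - 1 + T"] that show ?thesis by simp
  next
    case False
    then have "mh_chain w p r (Suc T) = mh_chain_coupled w p r T"
      using mh_chain_coalesce_or_argmax[where w=w and p=p and r=r and i=T] pos r max by fastforce
    from mh_chain_coupled_eq[OF this, of "i - 1 + T"] that show ?thesis by simp
  qed
  then have "0 \<le> 1 / w (mh_chain w p r (i + T)) - 1 / w (mh_chain_coupled w p r (i - 1 + T))"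
    if "i \<ge> 1" for i
    using that mh_chain_pos[where w=w and p=p and r=r, OF pos]
    by (simp add: frac_le)
  moreover have "0 \<le> 1 / w (mh_chain w p r (0 + T))"
    using mh_chain_pos[where w=w and p=p and r=r, OF pos] by (simp add: less_imp_le)
  ultimately show ?thesis
    using c by (intro add_nonneg_nonneg sum_nonneg divide_nonneg_nonneg) auto
qed

theorem proposition1:
  fixes M :: "'w measure" and mu :: "'a measure"
    and P Pstar Q :: "'a \<Rightarrow> real" and Z :: real
    and Xprop :: "nat \<Rightarrow> 'w \<Rightarrow> 'a" and r :: "nat \<Rightarrow> 'w \<Rightarrow> real"
    and N :: "'w \<Rightarrow> nat" and T :: nat
  defines "w \<equiv> importance_weight Pstar Q"
  defines "X \<equiv> \<lambda>i \<omega>. mh_chain w (\<lambda>j. Xprop j \<omega>) (\<lambda>j. r j \<omega>) i"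
  defines "Xt \<equiv> \<lambda>i \<omega>. mh_chain_coupled w (\<lambda>j. Xprop j \<omega>) (\<lambda>j. r j \<omega>) i"
  defines "Y \<equiv> \<lambda>i \<omega>. 1 / w (X (i + T) \<omega>)"
  defines "Yt \<equiv> \<lambda>i \<omega>. 1 / w (Xt (i + T) \<omega>)"
  defines "S \<equiv> \<lambda>\<omega>. Y 0 \<omega> +
             (\<Sum>i = 1..N \<omega>. (Y i \<omega> - Yt (i - 1) \<omega>) / measure M {\<omega>' \<in> space M. N \<omega>' \<ge> i})"
  assumes M: "prob_space M"
    and Pstar_pos: "\<And>x. x \<in> space mu \<Longrightarrow> Pstar x > 0"
    and Pstar_int: "has_bochner_integral mu Pstar Z"
    and Z_pos: "Z > 0"
    and P: "\<And>x. x \<in> space mu \<Longrightarrow> P x = Pstar x / Z"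
    and Q_pos: "\<And>x. x \<in> space mu \<Longrightarrow> Q x > 0"
    and Q_int: "has_bochner_integral mu Q 1"
    and Xprop_distr: "\<And>i. distributed M mu (Xprop i) (\<lambda>x. ennreal (Q x))"
    and Xprop_indep: "prob_space.indep_vars M (\<lambda>_. mu) Xprop UNIV"
    and r_distr: "\<And>i. distr M lborel (r i) = uniform_measure lborel {0..1}"
    and r_indep: "prob_space.indep_vars M (\<lambda>_. borel) r UNIV"
    and Xprop_r_indep:
      "indep_rv M (PiM UNIV (\<lambda>_. mu)) (\<lambda>\<omega> i. Xprop i \<omega>) (PiM UNIV (\<lambda>_. borel)) (\<lambda>\<omega> i. r i \<omega>)"
    and N_indep:
      "indep_rv M (count_space UNIV) N (PiM UNIV (\<lambda>_. mu \<Otimes>\<^sub>M mu)) (\<lambda>\<omega> i. (X i \<omega>, Xt i \<omega>))"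
    and N_pos: "\<And>i. measure M {\<omega> \<in> space M. N \<omega> \<ge> i} > 0"
  shows "measure M {\<omega> \<in> space M. S \<omega> \<ge> 0} \<ge> 1 - 2 / (real T + 1)"
proof -
  interpret prob_space M by (rule M)
  have Xprop_meas: "Xprop i \<in> M \<rightarrow>\<^sub>M mu" for i
    using Xprop_distr by (simp add: distributed_def)
  have r_meas [measurable]: "r i \<in> borel_measurable M" for i
    using r_indep by (auto simp: indep_vars_def)
  have N_meas [measurable]: "N \<in> M \<rightarrow>\<^sub>M count_space UNIV"
    and XXt_meas: "(\<lambda>\<omega> i. (X i \<omega>, Xt i \<omega>)) \<in> M \<rightarrow>\<^sub>M (\<Pi>\<^sub>M i\<in>UNIV. mu \<Otimes>\<^sub>M mu)"
    using N_indep by (auto simp: indep_rv_def)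
  \<comment> \<open>Measurability of both chains is read off from that of the joint process,
    contained in \<open>N_indep\<close>.\<close>
  have "(\<lambda>\<omega>. (X i \<omega>, Xt i \<omega>)) \<in> M \<rightarrow>\<^sub>M mu \<Otimes>\<^sub>M mu" for i
    using measurable_compose[OF XXt_meas measurable_component_singleton[of i]] by simp
  then have X_meas: "X i \<in> M \<rightarrow>\<^sub>M mu" and Xt_meas: "Xt i \<in> M \<rightarrow>\<^sub>M mu" for i
    using measurable_compose[OF _ measurable_fst] measurable_compose[OF _ measurable_snd] by force+
  have w_meas: "w \<in> borel_measurable mu"
    using borel_measurable_has_bochner_integral[OF Pstar_int]
      borel_measurable_has_bochner_integral[OF Q_int]
    unfolding w_def importance_weight_def[abs_def] by (rule borel_measurable_divide)
  have w_pos: "0 < w x" if "x \<in> space mu" for x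
    using that Pstar_pos Q_pos by (simp add: w_def importance_weight_def)
  have [measurable]: "Y i \<in> borel_measurable M" "Yt i \<in> borel_measurable M" for i
    unfolding Y_def Yt_def
    by (intro borel_measurable_divide borel_measurable_const measurable_compose[OF X_meas w_meas]
        measurable_compose[OF Xt_meas w_meas])+
  \<comment> \<open>The number of summands is random: measurability is shown for fixed
    \<open>n\<close> and transferred along the countably valued \<open>N\<close>.\<close>
  have "(\<lambda>\<omega>. Y 0 \<omega> + (\<Sum>i = 1..n. (Y i \<omega> - Yt (i - 1) \<omega>) / c i)) \<in> borel_measurable M"
    for n :: nat and c :: "nat \<Rightarrow> real"
    by measurable
  from measurable_compose_countable[OF this N_meas]
  have S_meas [measurable]: "S \<in> borel_measurable M"
    unfolding S_def .

  let ?V = "\<lambda>i \<omega>. w (Xprop i \<omega>)"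
  \<comment> \<open>The exceptional event: proposal 1 strictly outweighs all other proposals among
    \<open>0, ..., T + 1\<close>. These are \<open>T + 2\<close> proposals, whence the bound
    \<open>1 / (T + 2)\<close>.\<close>
  let ?G = "{\<omega> \<in> space M. \<forall>j\<in>{..Suc T} - {1}. ?V j \<omega> < ?V 1 \<omega>}"
  have V_meas [measurable]: "?V i \<in> borel_measurable M" for i
    by (rule measurable_compose[OF Xprop_meas w_meas])
  have G_meas [measurable]: "?G \<in> events" by measurable
  have "indep_vars (\<lambda>_. borel) ?V {..Suc T}"
    using indep_vars_compose2[OF Xprop_indep w_meas] by (rule indep_vars_subset) simp
  moreover have "distr M borel (?V i) = distr (density mu (\<lambda>x. ennreal (Q x))) borel w" for i
    using distr_distr[OF w_meas Xprop_meas] distributed_distr_eq_density[OF Xprop_distr]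
    by (simp add: comp_def)
  ultimately have G_le: "prob ?G \<le> 1 / card {..Suc T}"
    by (rule prob_strict_argmax_le) auto

  \<comment> \<open>At the endpoint 1, a null set, even a heavier proposal would be rejected,
    because acceptance is a strict inequality.\<close>
  have "AE \<omega> in M. r i \<omega> < 1" for i
  proof -
    have "AE x in uniform_measure lborel {0..1::real}. x < 1"
      using AE_lborel_singleton[of "1::real"] by (auto intro!: AE_uniform_measureI)
    then have "AE x in distr M lborel (r i). x < 1"
      unfolding r_distr .
    then show ?thesis
      by (subst (asm) AE_distr_iff) auto
  qed
  then have "AE \<omega> in M. \<forall>i. r i \<omega> < 1"
    by (simp add: AE_all_countable)
  moreover have "0 \<le> S \<omega>" if "\<forall>i. r i \<omega> < 1" "\<omega> \<in> space M - ?G" for \<omega>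
    unfolding S_def Y_def Yt_def X_def Xt_def
    using that measurable_space[OF Xprop_meas]
    by (intro mh_estimator_nonneg) (auto intro: w_pos)
  ultimately have "prob (space M - ?G) \<le> prob {\<omega> \<in> space M. 0 \<le> S \<omega>}"
    by (intro finite_measure_mono_AE) auto
  then have "1 - 1 / card {..Suc T} \<le> prob {\<omega> \<in> space M. 0 \<le> S \<omega>}"
    using G_le prob_compl[OF G_meas] by linarith
  \<comment> \<open>The argument yields the sharper failure bound \<open>1 / (T + 2)\<close>,
    relaxed here to the stated one.\<close>
  moreover have "1 / (real T + 2) \<le> 2 / (real T + 1)"
    by (simp add: field_simps)
  ultimately show ?thesis by (simp add: add.commute)
qed

end
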